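(* Let $n\ge 3$ and $m\ge 2$. Then player B wins the general position avoidance game on the grid $P_n\,\square\,P_m$, where $P_k$ denotes the path on $k$ vertices.
   Context: The Cartesian product $G\,\square\,H$ has vertex set $V(G)\times V(H)$, with $(g_1,h_1)$ adjacent to $(g_2,h_2)$ iff either $g_1=g_2$ and $h_1h_2\in E(H)$, or $h_1=h_2$ and $g_1g_2\in E(G)$. A set $S$ of vertices of a graph is a general position set if no three distinct vertices of $S$ lie on a common shortest path. In the general position avoidance game on a graph, players A and B alternately select vertices, with A moving first; a selection is legal if the vertex was not selected before and the set of all selected vertices is a general position set. The game ends when no legal move remains, and the player who selects the last vertex loses. "Player X wins" means X has a winning strategy. *)

theory Defs
  imports Main
begin

record 'a graph =
  verts :: "'a set"
  edges :: "'a set set"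

definition simple_graph :: "'a graph \<Rightarrow> bool" where
  "simple_graph G \<longleftrightarrow> (\<forall>e \<in> edges G. e \<subseteq> verts G \<and> card e = 2)"

definition path_graph :: "nat \<Rightarrow> nat graph" where
  "path_graph k = \<lparr>verts = {..<k}, edges = {{i, Suc i} | i. Suc i < k}\<rparr>"

definition cartesian_product :: "'a graph \<Rightarrow> 'b graph \<Rightarrow> ('a \<times> 'b) graph"
    (infixr \<open>\<box>\<close> 70) where
  "G \<box> H = \<lparr>verts = verts G \<times> verts H,
     edges = {{(g1, h1), (g2, h2)} | g1 h1 g2 h2.
       (g1, h1) \<in> verts G \<times> verts H \<and> (g2, h2) \<in> verts G \<times> verts H \<and>
       (g1 = g2 \<and> {h1, h2} \<in> edges H \<or> h1 = h2 \<and> {g1, g2} \<in> edges G)}\<rparr>"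

lemma simple_graph_path_graph: "simple_graph (path_graph k)"
  by (auto simp: simple_graph_def path_graph_def)

lemma simple_graph_cartesian_product:
  assumes "simple_graph G" "simple_graph H"
  shows "simple_graph (G \<box> H)"
proof -
  have "g1 \<noteq> g2" if "{g1, g2} \<in> edges G" for g1 g2
    using assms(1) that by (force simp: simple_graph_def)
  moreover have "h1 \<noteq> h2" if "{h1, h2} \<in> edges H" for h1 h2
    using assms(2) that by (force simp: simple_graph_def)
  ultimately show ?thesis
    by (auto simp: simple_graph_def cartesian_product_def card_insert_if)
qed

text \<open>A path is given by the list of its vertices.\<close>

definition is_path :: "'a graph \<Rightarrow> 'a list \<Rightarrow> bool" where
  "is_path G p \<longleftrightarrow> p \<noteq> [] \<and> distinct p \<and> set p \<subseteq> verts G \<and>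
     (\<forall>i. Suc i < length p \<longrightarrow> {p ! i, p ! Suc i} \<in> edges G)"

definition is_shortest_path :: "'a graph \<Rightarrow> 'a list \<Rightarrow> bool" where
  "is_shortest_path G p \<longleftrightarrow> is_path G p \<and>
     (\<forall>q. is_path G q \<and> hd q = hd p \<and> last q = last p \<longrightarrow> length p \<le> length q)"

definition general_position_set :: "'a graph \<Rightarrow> 'a set \<Rightarrow> bool" where
  "general_position_set G S \<longleftrightarrow> S \<subseteq> verts G \<and>
     \<not> (\<exists>x \<in> S. \<exists>y \<in> S. \<exists>z \<in> S. x \<noteq> y \<and> y \<noteq> z \<and> x \<noteq> z \<and>
          (\<exists>p. is_shortest_path G p \<and> {x, y, z} \<subseteq> set p))"

datatype player = PlayerA | PlayerB

text \<open>A position is the list of the vertices selected so far, in order of selection.\<close>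

definition to_move :: "'a list \<Rightarrow> player" where
  "to_move vs = (if even (length vs) then PlayerA else PlayerB)"

definition legal_move :: "'a graph \<Rightarrow> 'a list \<Rightarrow> 'a \<Rightarrow> bool" where
  "legal_move G vs v \<longleftrightarrow>
     v \<in> verts G \<and> v \<notin> set vs \<and> general_position_set G (insert v (set vs))"

definition is_play :: "'a graph \<Rightarrow> 'a list \<Rightarrow> bool" where
  "is_play G vs \<longleftrightarrow> (\<forall>k < length vs. legal_move G (take k vs) (vs ! k))"

definition game_over :: "'a graph \<Rightarrow> 'a list \<Rightarrow> bool" where
  "game_over G vs \<longleftrightarrow> \<not> (\<exists>v. legal_move G vs v)"

definition selected_last :: "player \<Rightarrow> 'a list \<Rightarrow> bool" where
  "selected_last X vs \<longleftrightarrow> vs \<noteq> [] \<and> to_move (butlast vs) = X"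

definition consistent_with :: "player \<Rightarrow> ('a list \<Rightarrow> 'a) \<Rightarrow> 'a list \<Rightarrow> bool" where
  "consistent_with X \<sigma> vs \<longleftrightarrow>
     (\<forall>k < length vs. to_move (take k vs) = X \<longrightarrow> vs ! k = \<sigma> (take k vs))"

text \<open>
  A strategy for \<open>X\<close> maps each position to the vertex that \<open>X\<close> selects there. On a finite graph
  every play is finite, so it suffices to speak about finite plays. The first conjunct makes the
  strategy supply a legal move whenever there is one; without it, a strategy proposing illegal
  moves could be winning vacuously.
\<close>

definition winning_strategy :: "'a graph \<Rightarrow> player \<Rightarrow> ('a list \<Rightarrow> 'a) \<Rightarrow> bool" where
  "winning_strategy G X \<sigma> \<longleftrightarrow>
     (\<forall>vs. is_play G vs \<and> consistent_with X \<sigma> vs \<longrightarrow>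
        (\<not> game_over G vs \<and> to_move vs = X \<longrightarrow> legal_move G vs (\<sigma> vs)) \<and>
        (game_over G vs \<longrightarrow> (\<exists>Y. Y \<noteq> X \<and> selected_last Y vs)))"

definition wins_avoidance_game :: "player \<Rightarrow> 'a graph \<Rightarrow> bool" where
  "wins_avoidance_game X G \<longleftrightarrow> (\<exists>\<sigma>. winning_strategy G X \<sigma>)"

end

theory Submission
  imports Defs
begin

text \<open>
  Three vertices of the grid lie on a common shortest path iff one of them is in the bounding box of
  the other two. Player B answers the first vertex \<open>v\<close> with a corner \<open>u\<close> of the grid. Ordering the
  vertices by membership in the boxes spanned with \<open>u\<close>, the other vertices of a general position
  set containing \<open>u\<close> form an antichain, and of three vertices of an antichain one is in the box of
  the other two. Hence no fourth vertex can ever be selected, and B wins as soon as the corner is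
  chosen so that a third one can.
\<close>

section \<open>Reduction of the game to plays of exactly three moves\<close>

text \<open>B moves once, after the first vertex, and A is then forced to make the third and last
  selection.\<close>

lemma wins_avoidance_game_PlayerB_if_three_moves:
  assumes "verts G \<noteq> {}"
    and reply: "\<And>v. v \<in> verts G \<Longrightarrow> \<exists>u. legal_move G [v] u \<and> (\<exists>w. legal_move G [v, u] w) \<and>
      (\<forall>w w'. legal_move G [v, u] w \<longrightarrow> \<not> legal_move G [v, u, w] w')"
  shows "wins_avoidance_game PlayerB G"
proof -
  obtain f where f: "\<And>v. v \<in> verts G \<Longrightarrow> legal_move G [v] (f v)"
      "\<And>v. v \<in> verts G \<Longrightarrow> \<exists>w. legal_move G [v, f v] w"
      "\<And>v w w'. v \<in> verts G \<Longrightarrow> legal_move G [v, f v] w \<Longrightarrow> \<not> legal_move G [v, f v, w] w'"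
    using reply by metis
  obtain v0 where v0: "v0 \<in> verts G" using assms(1) by blast
  \<comment> \<open>In the empty position nobody has selected last, so it must not be
    terminal.\<close>
  have start: "legal_move G [] v0"
    using v0 by (auto simp: legal_move_def general_position_set_def)
  \<comment> \<open>Looking at the first vertex suffices: the only consistent positions in which B
    is to move and the game is not over have length 1.\<close>
  define \<sigma> where "\<sigma> vs = f (hd vs)" for vs
  have "(\<not> game_over G vs \<and> to_move vs = PlayerB \<longrightarrow> legal_move G vs (\<sigma> vs)) \<and>
      (game_over G vs \<longrightarrow> (\<exists>Y. Y \<noteq> PlayerB \<and> selected_last Y vs))"
    if play: "is_play G vs" and cons: "consistent_with PlayerB \<sigma> vs" for vs
  proof -
    have legal: "legal_move G (take k vs) (vs ! k)" if "k < length vs" for k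
      using play that by (simp add: is_play_def)
    have first: "hd vs \<in> verts G" if "vs \<noteq> []"
      using legal[of 0] that by (simp add: legal_move_def hd_conv_nth)
    have second: "u = f v" if "vs = v # u # ws" for v u ws
      using cons that by (auto simp: consistent_with_def to_move_def \<sigma>_def dest: spec[of _ 1])
    consider "vs = []" | v where "vs = [v]" | v u where "vs = [v, u]"
      | v u w where "vs = [v, u, w]" | v u w w' ws where "vs = v # u # w # w' # ws"
      by (metis list.exhaust)
    then show ?thesis
    proof cases
      case 1
      then show ?thesis using start by (auto simp: game_over_def to_move_def)
    next
      case 2
      then show ?thesis using first f(1) by (auto simp: game_over_def \<sigma>_def)
    next
      case 3
      then show ?thesis using first second f(2) by (auto simp: game_over_def to_move_def)
    next
      case 4
      then have "v \<in> verts G" "u = f v" "legal_move G [v, u] w"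
        using first second legal[of 2] by (auto simp: numeral_2_eq_2)
      then have "game_over G vs"
        using 4 f(3) by (auto simp: game_over_def)
      then show ?thesis
        using 4 by (auto simp: selected_last_def to_move_def intro!: exI[of _ PlayerA])
    next
      case 5
      then have "v \<in> verts G" "u = f v" "legal_move G [v, u] w" "legal_move G [v, u, w] w'"
        using first second legal[of 2] legal[of 3] by (auto simp: numeral_2_eq_2 numeral_3_eq_3)
      then show ?thesis using f(3) by blast
    qed
  qed
  then show ?thesis
    unfolding wins_avoidance_game_def winning_strategy_def by blast
qed

section \<open>Distance and betweenness in coordinates\<close>

text \<open>Because of truncated subtraction, the sum below is the absolute difference.\<close>

definition nat_dist :: "nat \<Rightarrow> nat \<Rightarrow> nat" where
  "nat_dist a b = (a - b) + (b - a)"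

lemma nat_dist_triangle: "nat_dist a c \<le> nat_dist a b + nat_dist b c"
  unfolding nat_dist_def by linarith

lemma nat_dist_add_eq_iff:
  "nat_dist a b + nat_dist b c = nat_dist a c \<longleftrightarrow> a \<le> b \<and> b \<le> c \<or> c \<le> b \<and> b \<le> a"
  unfolding nat_dist_def by linarith

text \<open>Seen from an end of a path all vertices lie on one side, so comparing distances amounts
  to betweenness.\<close>

lemma nat_dist_end_le_iff:
  assumes "e = 0 \<or> e = k - 1" "a < k" "b < k"
  shows "nat_dist e a \<le> nat_dist e b \<longleftrightarrow> e \<le> a \<and> a \<le> b \<or> b \<le> a \<and> a \<le> e"
  using assms(1)
proof
  assume "e = 0"
  then show ?thesis by (auto simp: nat_dist_def)
next
  assume "e = k - 1"
  then have "a \<le> e" "b \<le> e" using assms(2,3) by simp_all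
  then have "nat_dist e a = e - a" "nat_dist e b = e - b" by (simp_all add: nat_dist_def)
  then show ?thesis using \<open>a \<le> e\<close> \<open>b \<le> e\<close> by linarith
qed

lemma nat_dist_end_between:
  assumes "e = 0 \<or> e = k - 1" "a < k" "b < k" "c < k"
    and "nat_dist e a < nat_dist e b" "nat_dist e b < nat_dist e c"
  shows "a \<le> b \<and> b \<le> c \<or> c \<le> b \<and> b \<le> a"
proof -
  have "e \<le> a \<and> a \<le> b \<or> b \<le> a \<and> a \<le> e" "e \<le> b \<and> b \<le> c \<or> c \<le> b \<and> b \<le> e"
    using assms nat_dist_end_le_iff[of e k a b] nat_dist_end_le_iff[of e k b c] by simp_all
  moreover have "a \<noteq> b" "b \<noteq> c" using assms(5,6) by auto
  ultimately show ?thesis by linarith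
qed

definition manhattan :: "nat \<times> nat \<Rightarrow> nat \<times> nat \<Rightarrow> nat" where
  "manhattan p q = nat_dist (fst p) (fst q) + nat_dist (snd p) (snd q)"

lemma manhattan_triangle: "manhattan p r \<le> manhattan p q + manhattan q r"
  using nat_dist_triangle[of "fst p" "fst r" "fst q"] nat_dist_triangle[of "snd p" "snd r" "snd q"]
  by (simp add: manhattan_def)

lemma manhattan_eq_0_iff: "manhattan p q = 0 \<longleftrightarrow> p = q"
  by (auto simp: manhattan_def nat_dist_def prod_eq_iff)

lemma manhattan_commute: "manhattan p q = manhattan q p"
  by (simp add: manhattan_def nat_dist_def)

text \<open>Equality in the triangle inequality, with the middle argument in between. This form
  suits walks; \<open>aligned_iff\<close> turns it into the bounding box.\<close>

definition aligned :: "nat \<times> nat \<Rightarrow> nat \<times> nat \<Rightarrow> nat \<times> nat \<Rightarrow> bool" where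
  "aligned x y z \<longleftrightarrow> manhattan x y + manhattan y z = manhattan x z"

text \<open>The triangle inequality holds in each coordinate, so the sum is tight only if both
  coordinates are.\<close>

lemma aligned_iff:
  "aligned (a, b) (c, d) (e, f) \<longleftrightarrow>
    (a \<le> c \<and> c \<le> e \<or> e \<le> c \<and> c \<le> a) \<and> (b \<le> d \<and> d \<le> f \<or> f \<le> d \<and> d \<le> b)"
  using nat_dist_triangle[of a e c] nat_dist_triangle[of b f d]
  unfolding aligned_def manhattan_def fst_conv snd_conv nat_dist_add_eq_iff[symmetric] by linarith

section \<open>Walks and shortest paths in the grid\<close>

lemma edge_path_graph_iff:
  "{i, j} \<in> edges (path_graph k) \<longleftrightarrow> i < k \<and> j < k \<and> (j = Suc i \<or> i = Suc j)"
  by (auto simp: path_graph_def doubleton_eq_iff)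

context
  fixes n m :: nat
begin

abbreviation grid :: "(nat \<times> nat) graph" where
  "grid \<equiv> path_graph n \<box> path_graph m"

lemma verts_grid: "verts grid = {..<n} \<times> {..<m}"
  by (simp add: cartesian_product_def path_graph_def)

lemma edge_grid_iff:
  "{p, q} \<in> edges grid \<longleftrightarrow> p \<in> verts grid \<and> q \<in> verts grid \<and> manhattan p q = 1"
proof -
  obtain a b c d where pq: "p = (a, b)" "q = (c, d)" by (cases p, cases q)
  have "{p, q} \<in> edges grid \<longleftrightarrow> p \<in> verts grid \<and> q \<in> verts grid \<and>
      (a = c \<and> {b, d} \<in> edges (path_graph m) \<or> b = d \<and> {a, c} \<in> edges (path_graph n))"
    unfolding pq cartesian_product_def
    by (auto simp: doubleton_eq_iff insert_commute)
  also have "\<dots> \<longleftrightarrow> p \<in> verts grid \<and> q \<in> verts grid \<and> manhattan p q = 1"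
    unfolding edge_path_graph_iff verts_grid pq manhattan_def nat_dist_def by auto
  finally show ?thesis .
qed

text \<open>Vertices may repeat here; for shortest walks distinctness is recovered in
  \<open>is_path_geodesic\<close>.\<close>

abbreviation walk :: "(nat \<times> nat) list \<Rightarrow> bool" where
  "walk p \<equiv> set p \<subseteq> verts grid \<and> (\<forall>i. Suc i < length p \<longrightarrow> {p ! i, p ! Suc i} \<in> edges grid)"

lemma manhattan_walk_le:
  assumes "walk p" "i \<le> j" "j < length p"
  shows "manhattan (p ! i) (p ! j) \<le> j - i"
  using assms(2,3)
proof (induction j rule: dec_induct)
  case base
  then show ?case by (simp add: manhattan_eq_0_iff)
next
  case (step j)
  have "manhattan (p ! j) (p ! Suc j) = 1"
    using assms(1) step.prems by (auto simp: edge_grid_iff)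
  then show ?case
    using step manhattan_triangle[of "p ! i" "p ! Suc j" "p ! j"] by simp
qed

text \<open>The upper bounds for the three segments cut off at \<open>i\<close> and \<open>j\<close>
  add up to the length of the walk, which is at most the distance of its ends; hence each bound is
  attained.\<close>

lemma manhattan_geodesic:
  assumes "walk p" "p \<noteq> []" "length p \<le> Suc (manhattan (hd p) (last p))"
    and "i \<le> j" "j < length p"
  shows "manhattan (p ! i) (p ! j) = j - i"
proof -
  let ?l = "length p - 1"
  have "manhattan (p ! 0) (p ! i) \<le> i" "manhattan (p ! i) (p ! j) \<le> j - i"
    "manhattan (p ! j) (p ! ?l) \<le> ?l - j"
    using manhattan_walk_le[OF assms(1), of 0 i] manhattan_walk_le[OF assms(1), of i j]
      manhattan_walk_le[OF assms(1), of j ?l] assms(4,5) by auto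
  moreover have "manhattan (p ! 0) (p ! ?l) \<ge> ?l"
    using assms(2,3) by (simp add: hd_conv_nth last_conv_nth)
  moreover note manhattan_triangle[of "p ! 0" "p ! ?l" "p ! i"]
    manhattan_triangle[of "p ! i" "p ! ?l" "p ! j"]
  ultimately show ?thesis using assms(4,5) by linarith
qed

lemma neighbour_towards:
  assumes "p \<in> verts grid" "q \<in> verts grid" "p \<noteq> q"
  obtains r where "{p, r} \<in> edges grid" "Suc (manhattan r q) = manhattan p q"
proof -
  obtain a b c d where pq: "p = (a, b)" "q = (c, d)" by (cases p, cases q)
  consider "a < c" | "c < a" | "b < d" | "d < b" using assms(3) pq by force
  then show ?thesis
  proof cases
    case 1
    then show ?thesis using that[of "(Suc a, b)"] assms pq
      by (auto simp: edge_grid_iff verts_grid manhattan_def nat_dist_def)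
  next
    case 2
    then show ?thesis using that[of "(a - 1, b)"] assms pq
      by (auto simp: edge_grid_iff verts_grid manhattan_def nat_dist_def)
  next
    case 3
    then show ?thesis using that[of "(a, Suc b)"] assms pq
      by (auto simp: edge_grid_iff verts_grid manhattan_def nat_dist_def)
  next
    case 4
    then show ?thesis using that[of "(a, b - 1)"] assms pq
      by (auto simp: edge_grid_iff verts_grid manhattan_def nat_dist_def)
  qed
qed

text \<open>Induction on the distance: step towards \<open>y\<close> until it is reached, then
  towards \<open>z\<close>.\<close>

lemma walk_through:
  assumes "x \<in> verts grid" "y \<in> verts grid" "z \<in> verts grid"
    and "manhattan x y + manhattan y z = manhattan x z"
  shows "\<exists>p. walk p \<and> p \<noteq> [] \<and> hd p = x \<and> last p = z \<and> y \<in> set p \<and>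
    length p = Suc (manhattan x z)"
  using assms
proof (induction "manhattan x z" arbitrary: x y)
  case 0
  then have "manhattan x z = 0" "manhattan y z = 0" by simp_all
  then have "x = z" "y = z" by (simp_all add: manhattan_eq_0_iff)
  then show ?case using 0 by (intro exI[of _ "[z]"]) (simp add: manhattan_eq_0_iff)
next
  case (Suc d)
  \<comment> \<open>\<open>y'\<close> is the vertex the remaining walk must visit: \<open>y\<close>
    itself, or the dummy \<open>z\<close> once \<open>x = y\<close>.\<close>
  obtain x' y' where x': "{x, x'} \<in> edges grid" "Suc (manhattan x' z) = manhattan x z"
    and y': "y' \<in> verts grid" "manhattan x' y' + manhattan y' z = manhattan x' z"
      "y = x \<or> y = y'"
  proof (cases "x = y")
    case True
    have "x \<noteq> z" using Suc.hyps(2) manhattan_eq_0_iff[of x z] by auto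
    then obtain r where r: "{x, r} \<in> edges grid" "Suc (manhattan r z) = manhattan x z"
      using neighbour_towards Suc.prems by metis
    show ?thesis
      using that[OF r, of z] True Suc.prems manhattan_eq_0_iff[of z z] by simp
  next
    case False
    then obtain r where r: "{x, r} \<in> edges grid" "Suc (manhattan r y) = manhattan x y"
      using neighbour_towards Suc.prems by metis
    have "manhattan x r = 1" using r(1) by (simp add: edge_grid_iff)
    \<comment> \<open>A step towards \<open>y\<close> also approaches \<open>z\<close>: two triangle
      inequalities pin down the distance from \<open>r\<close> to \<open>z\<close>.\<close>
    then have "Suc (manhattan r z) = manhattan x z"
        "manhattan r y + manhattan y z = manhattan r z"
      using r(2) Suc.prems(4) manhattan_triangle[of x z r] manhattan_triangle[of r z y] by auto
    then show ?thesis using that r(1) Suc.prems(2) by blast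
  qed
  have "x' \<in> verts grid" using x'(1) by (simp add: edge_grid_iff)
  then obtain p where p: "walk p" "p \<noteq> []" "hd p = x'" "last p = z" "y' \<in> set p"
      "length p = Suc (manhattan x' z)"
    using Suc.hyps(1)[of x' y'] Suc.hyps(2) Suc.prems(3) x'(2) y' by auto
  have "walk (x # p)"
    using p(1-3) x'(1) Suc.prems(1) by (auto simp: nth_Cons hd_conv_nth split: nat.split)
  then show ?case
    using p x'(2) y'(3) by (intro exI[of _ "x # p"]) auto
qed

lemma is_path_geodesic:
  assumes "walk p" "p \<noteq> []" "length p \<le> Suc (manhattan (hd p) (last p))"
  shows "is_path grid p"
proof -
  have "p ! i \<noteq> p ! j" if "i < j" "j < length p" for i j
    using manhattan_geodesic[OF assms, of i j] that manhattan_eq_0_iff[of "p ! i" "p ! j"] by auto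
  then have "distinct p" unfolding distinct_conv_nth by (metis linorder_neqE_nat)
  then show ?thesis using assms(1,2) by (simp add: is_path_def)
qed

text \<open>\<open>walk_through\<close> yields a walk attaining the distance of the ends, and
  \<open>manhattan_walk_le\<close> excludes shorter ones, so an upper bound on the length is
  enough.\<close>

lemma is_shortest_path_grid_iff:
  "is_shortest_path grid p \<longleftrightarrow> walk p \<and> p \<noteq> [] \<and> length p \<le> Suc (manhattan (hd p) (last p))"
  (is "?L \<longleftrightarrow> ?R")
proof
  assume ?L
  then have p: "walk p" "p \<noteq> []"
    and min: "\<And>q. is_path grid q \<Longrightarrow> hd q = hd p \<Longrightarrow> last q = last p \<Longrightarrow> length p \<le> length q"
    by (auto simp: is_shortest_path_def is_path_def)
  have "hd p \<in> verts grid" "last p \<in> verts grid" using p by auto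
  then obtain q where q: "walk q" "q \<noteq> []" "hd q = hd p" "last q = last p"
      "length q = Suc (manhattan (hd p) (last p))"
    using walk_through[of "hd p" "hd p" "last p"] by (auto simp: manhattan_eq_0_iff)
  then have "is_path grid q" by (intro is_path_geodesic) simp_all
  then show ?R using p q min[of q] by simp
next
  assume R: ?R
  have "length p \<le> length q" if "is_path grid q" "hd q = hd p" "last q = last p" for q
  proof -
    have q: "walk q" "q \<noteq> []" using that(1) by (auto simp: is_path_def)
    then have "manhattan (hd q) (last q) \<le> length q - 1"
      using manhattan_walk_le[of q 0 "length q - 1"] by (simp add: hd_conv_nth last_conv_nth)
    moreover have "length q > 0" using q(2) by simp
    moreover have "length p \<le> Suc (manhattan (hd q) (last q))" using R that by simp
    ultimately show ?thesis by linarith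
  qed
  then show ?L using R is_path_geodesic by (auto simp: is_shortest_path_def)
qed

text \<open>On a shortest path distances are index differences, and one of three indices lies
  between the other two.\<close>

lemma aligned_if_on_shortest_path:
  assumes "is_shortest_path grid p" "{x, y, z} \<subseteq> set p"
  shows "aligned x y z \<or> aligned y z x \<or> aligned z x y"
proof -
  have p: "walk p" "p \<noteq> []" "length p \<le> Suc (manhattan (hd p) (last p))"
    using assms(1) by (auto simp: is_shortest_path_grid_iff)
  obtain i j k where ijk: "i < length p" "j < length p" "k < length p"
      "x = p ! i" "y = p ! j" "z = p ! k"
    using assms(2) by (auto simp: in_set_conv_nth)
  have d: "manhattan (p ! s) (p ! t) = nat_dist s t" if "s < length p" "t < length p" for s t
    using manhattan_geodesic[OF p, of s t] manhattan_geodesic[OF p, of t s] that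
      manhattan_commute[of "p ! s" "p ! t"] by (cases "s \<le> t") (auto simp: nat_dist_def)
  show ?thesis
    unfolding aligned_def ijk using ijk(1-3) by (auto simp: d nat_dist_add_eq_iff)
qed

section \<open>General position in the grid and the corner reply\<close>

lemma general_position_set_grid_iff:
  "general_position_set grid S \<longleftrightarrow> S \<subseteq> verts grid \<and>
    (\<forall>x \<in> S. \<forall>y \<in> S. \<forall>z \<in> S. x \<noteq> y \<longrightarrow> y \<noteq> z \<longrightarrow> x \<noteq> z \<longrightarrow> \<not> aligned x y z)"
  (is "?L \<longleftrightarrow> ?R")
proof
  assume L: ?L
  have "\<not> aligned x y z"
    if "x \<in> S" "y \<in> S" "z \<in> S" "x \<noteq> y" "y \<noteq> z" "x \<noteq> z" for x y z
  proof
    assume "aligned x y z"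
    moreover have "x \<in> verts grid" "y \<in> verts grid" "z \<in> verts grid"
      using L that by (auto simp: general_position_set_def)
    ultimately obtain p where "walk p" "p \<noteq> []" "hd p = x" "last p = z" "y \<in> set p"
        "length p = Suc (manhattan x z)"
      using walk_through[of x y z] by (auto simp: aligned_def)
    then have "is_shortest_path grid p" "{x, y, z} \<subseteq> set p"
      by (auto simp: is_shortest_path_grid_iff)
    then show False using L that unfolding general_position_set_def by blast
  qed
  then show ?R using L by (simp add: general_position_set_def)
next
  assume R: ?R
  have "\<not> (is_shortest_path grid p \<and> {x, y, z} \<subseteq> set p)"
    if "x \<in> S" "y \<in> S" "z \<in> S" "x \<noteq> y" "y \<noteq> z" "x \<noteq> z" for x y z p
    using R that aligned_if_on_shortest_path[of p x y z] by metis
  moreover have "S \<subseteq> verts grid" using R by blast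
  ultimately show ?L unfolding general_position_set_def by blast
qed

lemma no_general_position_quadruple_with_corner:
  assumes corner: "u \<in> {0, n - 1} \<times> {0, m - 1}"
    and gp: "general_position_set grid {v, u, w, w'}"
    and "distinct [v, u, w, w']"
  shows False
proof -
  \<comment> \<open>\<open>A\<close> and \<open>B\<close> are coordinates measured from the corner
    \<open>u\<close>; in them, lying in a box spanned with \<open>u\<close> is the componentwise
    order.\<close>
  define A where "A p = nat_dist (fst u) (fst p)" for p :: "nat \<times> nat"
  define B where "B p = nat_dist (snd u) (snd p)" for p :: "nat \<times> nat"
  have bounds: "fst p < n" "snd p < m" if "p \<in> verts grid" for p
    using that by (auto simp: verts_grid)
  have ends: "fst u = 0 \<or> fst u = n - 1" "snd u = 0 \<or> snd u = m - 1" using corner by auto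
  have comparable: "aligned u p q \<longleftrightarrow> A p \<le> A q \<and> B p \<le> B q"
    if "p \<in> verts grid" "q \<in> verts grid" for p q
    using aligned_iff[of "fst u" "snd u" "fst p" "snd p" "fst q" "snd q"]
      nat_dist_end_le_iff[OF ends(1) bounds(1)[OF that(1)] bounds(1)[OF that(2)]]
      nat_dist_end_le_iff[OF ends(2) bounds(2)[OF that(1)] bounds(2)[OF that(2)]]
    by (simp add: A_def B_def)
  have anti: "A p < A q \<and> B q < B p \<or> A q < A p \<and> B p < B q"
    if "p \<in> verts grid" "q \<in> verts grid" "\<not> aligned u p q" "\<not> aligned u q p" for p q
    using that comparable[of p q] comparable[of q p] by linarith
  \<comment> \<open>In an antichain \<open>B\<close> decreases as \<open>A\<close> increases, so the
    middle element is in the middle in both coordinates.\<close>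
  have mid: "aligned p q r"
    if "p \<in> verts grid" "q \<in> verts grid" "r \<in> verts grid"
      "A p < A q" "A q < A r" "B r < B q" "B q < B p" for p q r
    using aligned_iff[of "fst p" "snd p" "fst q" "snd q" "fst r" "snd r"]
      nat_dist_end_between[OF ends(1) bounds(1)[OF that(1)] bounds(1)[OF that(2)]
        bounds(1)[OF that(3)]]
      nat_dist_end_between[OF ends(2) bounds(2)[OF that(3)] bounds(2)[OF that(2)]
        bounds(2)[OF that(1)]]
      that(4-7) by (auto simp: A_def B_def)
  have verts: "v \<in> verts grid" "w \<in> verts grid" "w' \<in> verts grid"
    using gp by (auto simp: general_position_set_grid_iff)
  have na: "\<not> aligned x y z"
    if "x \<in> {v, u, w, w'}" "y \<in> {v, u, w, w'}" "z \<in> {v, u, w, w'}"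
      "x \<noteq> y" "y \<noteq> z" "x \<noteq> z" for x y z
    using gp that unfolding general_position_set_grid_iff by blast
  have na_corner: "\<not> aligned u v w" "\<not> aligned u w v" "\<not> aligned u v w'" "\<not> aligned u w' v"
    "\<not> aligned u w w'" "\<not> aligned u w' w"
    using assms(3) by (intro na; auto)+
  have "\<not> aligned v w w'" "\<not> aligned v w' w" "\<not> aligned w v w'" "\<not> aligned w w' v"
    "\<not> aligned w' v w" "\<not> aligned w' w v"
    using assms(3) by (intro na; auto)+
  \<comment> \<open>By \<open>anti\<close>, the values of \<open>A\<close> order \<open>v\<close>,
    \<open>w\<close>, \<open>w'\<close> strictly; whichever is in the middle, \<open>mid\<close>
    contradicts general position.\<close>
  then show False
    using anti[OF verts(1,2) na_corner(1,2)] anti[OF verts(1,3) na_corner(3,4)]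
      anti[OF verts(2,3) na_corner(5,6)] mid verts by (metis less_asym)
qed

text \<open>Three non-alignments suffice, because \<open>aligned\<close> is symmetric in its outer
  arguments.\<close>

lemma corner_reply:
  assumes "n \<ge> 3" "m \<ge> 2" "v \<in> verts grid"
  obtains u w where "u \<in> {0, n - 1} \<times> {0, m - 1}" "w \<in> verts grid" "distinct [v, u, w]"
    "\<not> aligned v u w" "\<not> aligned u v w" "\<not> aligned v w u"
proof -
  obtain x y where v: "v = (x, y)" "x < n" "y < m"
    using assms(3) by (auto simp: verts_grid)
  \<comment> \<open>\<open>c\<close> always differs from \<open>x\<close>. For
    \<open>0 < x < n - 1\<close>, \<open>u\<close> and \<open>w\<close> are the two corners with
    second coordinate \<open>d\<close>, and \<open>d\<close> differs from \<open>y\<close>. If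
    \<open>v\<close> is on an end line \<open>x = 0\<close> or \<open>x = n - 1\<close> but not a
    corner, \<open>u\<close> and \<open>w\<close> are the corners of the opposite end line. If
    \<open>v\<close> is a corner, \<open>u\<close> is the other corner with the same second
    coordinate and \<open>w\<close> lies on the opposite side; \<open>n \<ge> 3\<close> puts its
    first coordinate 1 strictly between those of \<open>v\<close> and \<open>u\<close>.\<close>
  define c where "c = (if x = n - 1 then 0 else n - 1)"
  define d where "d = (if 0 < x \<and> x < n - 1 \<and> y = m - 1 \<or> y = 0 \<and> (x = 0 \<or> x = n - 1)
    then 0 else m - 1)"
  define w where "w = (if 0 < x \<and> x < n - 1 then (0, d)
    else if 0 < y \<and> y < m - 1 then (c, 0) else (1, m - 1 - d))"
  show ?thesis
    by (rule that[of "(c, d)" w])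
      (use assms(1,2) v in \<open>auto simp: c_def d_def w_def aligned_iff verts_grid split: if_splits\<close>)
qed

end

theorem theorem4p5:
  fixes n m :: nat
  assumes "n \<ge> 3" and "m \<ge> 2"
  shows "wins_avoidance_game PlayerB (path_graph n \<box> path_graph m)"
proof (rule wins_avoidance_game_PlayerB_if_three_moves)
  let ?G = "path_graph n \<box> path_graph m"
  show "verts ?G \<noteq> {}" using assms by (auto simp: verts_grid lessThan_empty_iff)
  fix v assume v: "v \<in> verts ?G"
  then obtain u w where u: "u \<in> {0, n - 1} \<times> {0, m - 1}" and w: "w \<in> verts ?G"
    and distinct: "distinct [v, u, w]"
    and na: "\<not> aligned v u w" "\<not> aligned u v w" "\<not> aligned v w u"
    using corner_reply[OF assms] by metis
  \<comment> \<open>Reversal supplies the remaining three orders of \<open>v\<close>,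
    \<open>u\<close>, \<open>w\<close>.\<close>
  have sym: "aligned x y z \<longleftrightarrow> aligned z y x" for x y z
    by (cases x, cases y, cases z) (auto simp: aligned_iff)
  have "u \<in> verts ?G" using u assms by (auto simp: verts_grid)
  then have "legal_move ?G [v] u" "legal_move ?G [v, u] w"
    using v w distinct na sym by (auto simp: legal_move_def general_position_set_grid_iff)
  moreover have "\<not> legal_move ?G [v, u, w1] w2" if "legal_move ?G [v, u] w1" for w1 w2
  proof
    assume "legal_move ?G [v, u, w1] w2"
    then show False
      using that distinct no_general_position_quadruple_with_corner[OF u, of v w1 w2]
      by (auto simp: legal_move_def insert_commute)
  qed
  ultimately show "\<exists>u. legal_move ?G [v] u \<and> (\<exists>w. legal_move ?G [v, u] w) \<and>
      (\<forall>w w'. legal_move ?G [v, u] w \<longrightarrow> \<not> legal_move ?G [v, u, w] w')"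
    by blast
qed

end
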